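(* For every prime power $q$ and every integer $n \geq 2$, there exists a resolvable $\left(\frac{q^n - 1}{q - 1} \times q^n,\ \frac{q(q^n - 1)}{q - 1}\right)$-unordered triple array.
   Context: An $(r \times c, v)$-unordered triple array on a set $V$ of $v$ symbols is a collection of $c$-subsets $R_1, \dots, R_r \subseteq V$ (row-sets) and $r$-subsets $C_1, \dots, C_c \subseteq V$ (column-sets) such that, for some integers $e, \lambda_{rc}, \lambda_{rr}, \lambda_{cc}$, each symbol lies in exactly $e$ row-sets and exactly $e$ column-sets, $|R_i \cap C_j| = \lambda_{rc}$ for all $i,j$, $|R_i \cap R_s| = \lambda_{rr}$ for all $i \neq s$, and $|C_j \cap C_t| = \lambda_{cc}$ for all $j \neq t$. Necessarily $e = rc/v$. Such an unordered triple array is called resolvable if $\lambda_{rrc} := \frac{e(e-1)}{r-1}$ and $k := \frac{c}{e}$ are integers and the symbol set can be partitioned into $r$ groups of size $k$ such that every column-set contains exactly one symbol from each group, and all symbols of a group lie in exactly the same row-sets. *)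

theory Defs
  imports "HOL-Number_Theory.Prime_Powers" "HOL-Library.Disjoint_Sets"
begin

text \<open>
  Row-sets and column-sets are indexed families, with indices \<open>i < r\<close> and \<open>j < c\<close>;
  repetitions are not excluded a priori. The parameters \<open>e\<close>, \<open>l_rc\<close>, \<open>l_rr\<close>, \<open>l_cc\<close>
  are cardinalities, hence natural numbers.
\<close>

definition uta_with_parameters ::
  "nat \<Rightarrow> nat \<Rightarrow> nat \<Rightarrow> 'a set \<Rightarrow> (nat \<Rightarrow> 'a set) \<Rightarrow> (nat \<Rightarrow> 'a set) \<Rightarrow> nat \<Rightarrow> nat \<Rightarrow> nat \<Rightarrow> nat \<Rightarrow> bool"
where
  "uta_with_parameters r c v V R C e l_rc l_rr l_cc \<longleftrightarrow>
     finite V \<and> card V = v \<and>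
     (\<forall>i<r. R i \<subseteq> V \<and> card (R i) = c) \<and>
     (\<forall>j<c. C j \<subseteq> V \<and> card (C j) = r) \<and>
     (\<forall>x\<in>V. card {i. i < r \<and> x \<in> R i} = e \<and> card {j. j < c \<and> x \<in> C j} = e) \<and>
     (\<forall>i<r. \<forall>j<c. card (R i \<inter> C j) = l_rc) \<and>
     (\<forall>i<r. \<forall>s<r. i \<noteq> s \<longrightarrow> card (R i \<inter> R s) = l_rr) \<and>
     (\<forall>j<c. \<forall>t<c. j \<noteq> t \<longrightarrow> card (C j \<inter> C t) = l_cc)"

definition unordered_triple_array ::
  "nat \<Rightarrow> nat \<Rightarrow> nat \<Rightarrow> 'a set \<Rightarrow> (nat \<Rightarrow> 'a set) \<Rightarrow> (nat \<Rightarrow> 'a set) \<Rightarrow> bool"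
where
  "unordered_triple_array r c v V R C \<longleftrightarrow>
     (\<exists>e l_rc l_rr l_cc. uta_with_parameters r c v V R C e l_rc l_rr l_cc)"

text \<open>
  The two divisibility conditions say that \<open>e (e - 1) / (r - 1)\<close> and \<open>k = c / e\<close> are integers.
  The number \<open>e\<close> is determined by the array as soon as \<open>V\<close> is nonempty.
\<close>

definition resolvable_unordered_triple_array ::
  "nat \<Rightarrow> nat \<Rightarrow> nat \<Rightarrow> 'a set \<Rightarrow> (nat \<Rightarrow> 'a set) \<Rightarrow> (nat \<Rightarrow> 'a set) \<Rightarrow> bool"
where
  "resolvable_unordered_triple_array r c v V R C \<longleftrightarrow>
     (\<exists>e l_rc l_rr l_cc. uta_with_parameters r c v V R C e l_rc l_rr l_cc \<and>
        (r - 1) dvd e * (e - 1) \<and> e dvd c \<and>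
        (\<exists>G. partition_on V G \<and> card G = r \<and>
             (\<forall>g\<in>G. card g = c div e) \<and>
             (\<forall>j<c. \<forall>g\<in>G. card (C j \<inter> g) = 1) \<and>
             (\<forall>g\<in>G. \<forall>x\<in>g. \<forall>y\<in>g. \<forall>i<r. x \<in> R i \<longleftrightarrow> y \<in> R i)))"

lemma resolvable_imp_unordered_triple_array:
  "resolvable_unordered_triple_array r c v V R C \<Longrightarrow> unordered_triple_array r c v V R C"
  unfolding resolvable_unordered_triple_array_def unordered_triple_array_def
  by (elim exE conjE, intro exI, assumption)

end

theory Submission
  imports Defs "HOL-Algebra.Algebraic_Closure" "HOL-Number_Theory.Residues"
begin

text \<open>
  Columns are the points of the affine space \<open>AG(n,q)\<close>, symbols are its affine hyperplanes, and a
  point is incident with the hyperplanes through it. The groups are the parallel classes, which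
  correspond to the points of \<open>PG(n-1,q)\<close> (the normal directions). Row-sets are unions of parallel
  classes: the row indexed by a point \<open>i\<close> of \<open>PG(n-1,q)\<close> consists of the classes whose normal
  direction is not orthogonal to \<open>i\<close>, so that rows against classes form the complement of the
  point-hyperplane design. The field with \<open>q = p ^ m\<close> elements is the set of roots of \<open>X ^ q - X\<close> in
  an algebraic closure of \<open>\<int>/p\<int>\<close>.
\<close>

section \<open>Finite fields of prime power order\<close>

text \<open>With x = X^q, y = X and z the constant -a in the polynomial ring, this turns (X - a)^q -
  (X - a) into X^q - X.\<close>

lemma (in abelian_group) add_minus_add_cancel_right:
  assumes "x \<in> carrier G" "y \<in> carrier G" "z \<in> carrier G"
  shows "(x \<oplus> z) \<ominus> (y \<oplus> z) = x \<oplus> \<ominus> y"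
proof -
  have "(x \<oplus> z) \<ominus> (y \<oplus> z) = x \<oplus> (z \<oplus> (\<ominus> z \<oplus> \<ominus> y))"
    using assms by (simp add: minus_eq minus_add a_comm a_assoc)
  thus ?thesis using assms by (simp add: r_neg2)
qed

lemma (in cring) binomial_expansion:
  assumes x: "x \<in> carrier R" and y: "y \<in> carrier R"
  shows "(x \<oplus> y) [^] (n::nat) = (\<Oplus>k\<in>{..n}. [(n choose k)] \<cdot> (x [^] k \<otimes> y [^] (n - k)))"
proof (induction n)
  case 0
  show ?case using x y by simp
next
  case (Suc n)
  let ?S = "\<Oplus>k\<in>{..n}. [(n choose k)] \<cdot> (x [^] k \<otimes> y [^] (n - k))"
  let ?A = "\<lambda>k. [(n choose k)] \<cdot> (x [^] Suc k \<otimes> y [^] (n - k))"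
  let ?B = "\<lambda>k. [(n choose k)] \<cdot> (x [^] k \<otimes> y [^] (Suc n - k))"
  let ?C = "\<lambda>k. [(Suc n choose k)] \<cdot> (x [^] k \<otimes> y [^] (Suc n - k))"
  have "?S \<otimes> x = (\<Oplus>k\<in>{..n}. ?A k)"
    using x y by (subst finsum_ldistr)
      (auto intro!: add.finprod_cong' simp: add_pow_rdistr m_assoc m_comm m_lcomm)
  moreover have "?S \<otimes> y = (\<Oplus>k\<in>{..n}. ?B k)"
    using x y by (subst finsum_ldistr)
      (auto intro!: add.finprod_cong' simp: add_pow_rdistr m_assoc m_comm m_lcomm Suc_diff_le)
  \<comment> \<open>The added term k = n + 1 has coefficient 0. Splitting off k = 0 afterwards
    aligns the powers with those of \<open>?A\<close>, so that Pascal's rule applies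
    termwise.\<close>
  moreover have "(\<Oplus>k\<in>{..n}. ?B k) = (\<Oplus>k\<in>{..Suc n}. ?B k)"
    using x y by (subst finsum_Suc) (auto simp: binomial_eq_0)
  moreover have "\<dots> = (\<Oplus>k\<in>{..n}. ?B (Suc k)) \<oplus> ?B 0"
    using x y by (subst finsum_Suc2) auto
  moreover have "(\<Oplus>k\<in>{..n}. ?A k) \<oplus> (\<Oplus>k\<in>{..n}. ?B (Suc k)) = (\<Oplus>k\<in>{..n}. ?C (Suc k))"
    using x y by (subst finsum_addf[symmetric]) (auto intro!: add.finprod_cong' simp: add.nat_pow_mult)
  moreover have "(\<Oplus>k\<in>{..Suc n}. ?C k) = (\<Oplus>k\<in>{..n}. ?C (Suc k)) \<oplus> ?C 0"
    using x y by (subst finsum_Suc2) auto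
  moreover have "(x \<oplus> y) [^] Suc n = ?S \<otimes> x \<oplus> ?S \<otimes> y"
    using x y Suc.IH by (simp add: r_distr)
  ultimately show ?case
    using x y by (simp add: a_assoc[symmetric] del: finsum_Suc finsum_Suc2)
qed

lemma (in ring_hom_ring) hom_add_pow_nat:
  assumes "x \<in> carrier R"
  shows "h ([(k::nat)] \<cdot> x) = [k] \<cdot>\<^bsub>S\<^esub> h x"
  using assms by (induction k) simp_all

text \<open>At k = m this shows that m times the unit vanishes, which yields the characteristic of
  the prime field.\<close>

lemma (in residues) add_pow_one: "[k] \<cdot> \<one> = int k mod m"
proof (induction k)
  case 0
  show ?case by (simp add: zero_cong)
next
  case (Suc k)
  thus ?case by (simp add: res_add_eq res_one_eq mod_simps add.commute)
qed

lemma (in cring) add_pow_eq_zero_of_dvd: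
  assumes "[p] \<cdot> \<one> = \<zero>" and "(p::nat) dvd k" and "z \<in> carrier R"
  shows "[k] \<cdot> z = \<zero>"
proof -
  obtain m where k: "k = p * m" using assms(2) by blast
  have "[p] \<cdot> z = ([p] \<cdot> \<one>) \<otimes> z"
    using assms(3) by (simp add: add_pow_ldistr)
  hence "[p] \<cdot> z = \<zero>" using assms(1,3) by simp
  thus ?thesis using assms(3) unfolding k by (simp flip: add.nat_pow_pow)
qed

text \<open>For 0 < k < p the prime p divides \<open>p choose k\<close>, so only the two outer terms
  of the binomial expansion survive.\<close>

lemma (in cring) frobenius_add:
  assumes p: "Factorial_Ring.prime p" and char: "[p] \<cdot> \<one> = \<zero>"
    and x: "x \<in> carrier R" and y: "y \<in> carrier R"
  shows "(x \<oplus> y) [^] (p::nat) = x [^] p \<oplus> y [^] p"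
proof -
  let ?f = "\<lambda>k. [(p choose k)] \<cdot> (x [^] k \<otimes> y [^] (p - k))"
  have "(x \<oplus> y) [^] p = (\<Oplus>k\<in>{..p}. ?f k)"
    by (rule binomial_expansion[OF x y])
  also have "\<dots> = (\<Oplus>k\<in>{0, p}. ?f k)"
  proof (rule add.finprod_mono_neutral_cong_right)
    show "?f k = \<zero>" if "k \<in> {..p} - {0, p}" for k
    proof (rule add_pow_eq_zero_of_dvd[OF char])
      show "p dvd p choose k"
        using that p by (intro dvd_choose_prime) auto
    qed (use x y in auto)
  qed (use x y in auto)
  also have "\<dots> = x [^] p \<oplus> y [^] p"
    using x y prime_gt_0_nat[OF p] by (simp add: a_comm)
  finally show ?thesis .
qed

lemma (in cring) frobenius_pow_add:
  assumes p: "Factorial_Ring.prime p" and char: "[p] \<cdot> \<one> = \<zero>"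
    and x: "x \<in> carrier R" and y: "y \<in> carrier R"
  shows "(x \<oplus> y) [^] (p ^ m) = x [^] (p ^ m) \<oplus> y [^] ((p::nat) ^ m)"
proof (induction m)
  case 0
  show ?case using x y by simp
next
  case (Suc m)
  have "(x \<oplus> y) [^] (p ^ Suc m) = ((x \<oplus> y) [^] (p ^ m)) [^] p"
    using x y by (simp add: nat_pow_pow mult.commute)
  also have "\<dots> = (x [^] (p ^ m)) [^] p \<oplus> (y [^] (p ^ m)) [^] p"
    unfolding Suc.IH using frobenius_add[OF p char] x y by simp
  finally show ?case
    using x y by (simp add: nat_pow_pow mult.commute)
qed

text \<open>Additivity of the power map is applied to -x + x = 0, which treats p = 2 and odd p
  alike.\<close>

lemma (in cring) frobenius_pow_uminus:
  assumes p: "Factorial_Ring.prime p" and char: "[p] \<cdot> \<one> = \<zero>" and x: "x \<in> carrier R"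
  shows "(\<ominus> x) [^] (p ^ m) = \<ominus> (x [^] ((p::nat) ^ m))"
proof -
  have "p ^ m \<noteq> 0" using prime_gt_0_nat[OF p] by simp
  hence "(\<ominus> x) [^] (p ^ m) \<oplus> x [^] (p ^ m) = \<zero>"
    using frobenius_pow_add[OF p char, of "\<ominus> x" x m] x by (simp add: l_neg nat_pow_zero)
  thus ?thesis using x by (simp add: minus_equality)
qed

section \<open>The roots of X^q - X and the field with q elements\<close>

text \<open>The fixed points are the roots of \<open>P\<close> = X^q - X. Over an algebraically
  closed field \<open>P\<close> has q roots counted with multiplicity, and all of them turn out to
  be simple.\<close>

lemma (in algebraically_closed) card_frobenius_pow_fixed:
  assumes p: "Factorial_Ring.prime p" and char: "[p] \<cdot> \<one> = \<zero>" and m: "m > 0"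
  shows "card {x \<in> carrier L. x [^] ((p::nat) ^ m) = x} = p ^ m"
proof -
  let ?q = "p ^ m"
  have q: "?q > 1"
    using prime_gt_1_nat[OF p] m by (simp add: one_less_power del: One_nat_def)
  interpret UP: domain "poly_ring L"
    by (rule univ_poly_is_domain[OF carrier_is_subring])
  interpret C: ring_hom_ring "L\<lparr>carrier := carrier L\<rparr>" "poly_ring L" poly_of_const
    by (rule canonical_embedding_ring_hom[OF carrier_is_subring])
  have C_closed: "poly_of_const a \<in> carrier (poly_ring L)" if "a \<in> carrier L" for a
    using C.hom_closed that by simp
  have C_pow: "poly_of_const a [^]\<^bsub>poly_ring L\<^esub> k = poly_of_const (a [^] k)"
    if "a \<in> carrier L" for a and k :: nat
    using C.hom_nat_pow[of a k] that by (simp add: nat_pow_consistent)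
  have C_char: "[p] \<cdot>\<^bsub>poly_ring L\<^esub> \<one>\<^bsub>poly_ring L\<^esub> = \<zero>\<^bsub>poly_ring L\<^esub>"
    using C.hom_add_pow_nat[of \<one> p] char C.hom_one C.hom_zero by (simp add: add_pow_def)
  have X: "X \<in> carrier (poly_ring L)"
    by (rule var_closed(1)[OF carrier_is_subring])
  \<comment> \<open>The polynomial -X as an explicit coefficient list, leading coefficient first, so
    that its degree can be read off.\<close>
  define Y where "Y = [\<ominus> \<one>, \<zero>]"
  have Y: "Y \<in> carrier (poly_ring L)"
    unfolding Y_def sym[OF univ_poly_carrier] polynomial_def by auto
  have "Y \<oplus>\<^bsub>poly_ring L\<^esub> X = \<zero>\<^bsub>poly_ring L\<^esub>"
    unfolding Y_def var_def univ_poly_add univ_poly_zero by (simp add: l_neg)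
  hence Y_eq: "Y = \<ominus>\<^bsub>poly_ring L\<^esub> X"
    using X Y by (simp add: UP.minus_equality)
  define P where "P = X [^]\<^bsub>poly_ring L\<^esub> ?q \<oplus>\<^bsub>poly_ring L\<^esub> Y"
  have P: "P \<in> carrier (poly_ring L)"
    unfolding P_def using X Y by simp
  \<comment> \<open>No leading terms cancel because the degrees q and 1 differ, as m > 0.\<close>
  have "degree (poly_add (monom \<one> ?q) Y) = max (degree (monom \<one> ?q)) (degree Y)"
  proof (rule poly_add_degree_eq[OF carrier_is_subring])
    show "polynomial (carrier L) (monom \<one> ?q)"
      by (rule monom_is_polynomial[OF carrier_is_subring]) simp
    show "polynomial (carrier L) Y"
      using Y by (simp add: univ_poly_carrier)
    show "degree (monom \<one> ?q) \<noteq> degree Y"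
      using m prime_gt_1_nat[OF p] by (simp add: monom_def Y_def)
  qed
  hence degree_P: "degree P = ?q"
    using q unfolding P_def univ_poly_add unitary_monom_eq_var_pow[OF carrier_is_subring, symmetric]
    by (simp add: Y_def monom_def)
  hence P_not_Nil: "P \<noteq> []"
    using prime_gt_0_nat[OF p] by auto

  have eval_P: "eval P a = a [^] ?q \<ominus> a" if a: "a \<in> carrier L" for a
  proof -
    interpret E: ring_hom_cring "poly_ring L" L "\<lambda>f. eval f a"
      by (rule eval_cring_hom[OF carrier_is_subring a])
    show ?thesis
      unfolding P_def Y_eq using X a by (simp add: eval_var minus_eq)
  qed
  have roots_P: "set_mset (roots P) = {x \<in> carrier L. x [^] ?q = x}"
    using roots_mem_iff_is_root[OF P] eval_P P_not_Nil by (auto simp: is_root_def)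

  \<comment> \<open>A root \<open>a\<close> is simple because \<open>P = (X - a) ^ q - (X - a)\<close> by additivity of Frobenius.\<close>
  have "count (roots P) a \<le> 1" for a
  proof (rule ccontr)
    assume "\<not> ?thesis"
    hence mult: "2 \<le> alg_mult P a"
      using alg_mult_eq_count_roots[OF P] by simp
    hence "a \<in># roots P"
      using alg_mult_eq_count_roots[OF P] by (simp flip: count_greater_zero_iff)
    hence a: "a \<in> carrier L" and a_fix: "a [^] ?q = a"
      using roots_P by auto
    interpret E: ring_hom_cring "poly_ring L" L "\<lambda>f. eval f a"
      by (rule eval_cring_hom[OF carrier_is_subring a])
    let ?C = "poly_of_const (\<ominus> a)"
    define U where "U = [\<one>, \<ominus> a]"
    have U: "U \<in> carrier (poly_ring L)"
      unfolding U_def sym[OF univ_poly_carrier] polynomial_def using a by auto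
    have U_eq: "U = X \<oplus>\<^bsub>poly_ring L\<^esub> ?C"
      unfolding U_def var_def univ_poly_add poly_of_const_def using a by simp
    have "(\<ominus> a) [^] ?q = \<ominus> a"
      using frobenius_pow_uminus[OF p char a] a_fix by simp
    hence "U [^]\<^bsub>poly_ring L\<^esub> ?q = X [^]\<^bsub>poly_ring L\<^esub> ?q \<oplus>\<^bsub>poly_ring L\<^esub> ?C"
      unfolding U_eq using UP.frobenius_pow_add[OF p C_char X C_closed, of "\<ominus> a" m] a
      by (simp add: C_pow)
    hence P_eq: "P = U [^]\<^bsub>poly_ring L\<^esub> ?q \<ominus>\<^bsub>poly_ring L\<^esub> U"
      unfolding P_def Y_eq using U_eq X C_closed[of "\<ominus> a"] a
      by (simp add: UP.add_minus_add_cancel_right)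
    obtain g where g: "g \<in> carrier (poly_ring L)"
      and P_g: "P = U [^]\<^bsub>poly_ring L\<^esub> (2::nat) \<otimes>\<^bsub>poly_ring L\<^esub> g"
      using le_alg_mult_imp_pdivides[OF a P mult] unfolding pdivides_def U_def by (auto elim: dividesE)
    \<comment> \<open>Cancelling one factor \<open>U\<close> from U^q - U = U^2 g leaves U^(q-1) - 1
      = U g. At a this reads 0 - 1 = 0, because q - 1 > 0.\<close>
    let ?V = "U [^]\<^bsub>poly_ring L\<^esub> (?q - 1) \<ominus>\<^bsub>poly_ring L\<^esub> \<one>\<^bsub>poly_ring L\<^esub>"
    have "U [^]\<^bsub>poly_ring L\<^esub> ?q = U \<otimes>\<^bsub>poly_ring L\<^esub> U [^]\<^bsub>poly_ring L\<^esub> (?q - 1)"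
      using UP.nat_pow_Suc2[OF U, of "?q - 1"] q by (metis Suc_diff_1 less_trans zero_less_one)
    hence "U \<otimes>\<^bsub>poly_ring L\<^esub> ?V = P"
      unfolding P_eq using U by (simp add: UP.minus_eq UP.r_distr UP.r_minus)
    also have "\<dots> = U \<otimes>\<^bsub>poly_ring L\<^esub> (U \<otimes>\<^bsub>poly_ring L\<^esub> g)"
      unfolding P_g using U g by (simp add: numeral_2_eq_2 UP.m_assoc)
    finally have "?V = U \<otimes>\<^bsub>poly_ring L\<^esub> g"
      using UP.m_lcancel[of U ?V "U \<otimes>\<^bsub>poly_ring L\<^esub> g"] U g by (simp add: U_def univ_poly_zero)
    hence "eval ?V a = eval (U \<otimes>\<^bsub>poly_ring L\<^esub> g) a" by simp
    moreover have "eval U a = \<zero>"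
      unfolding U_def using a by (simp add: r_neg)
    ultimately have "\<zero> [^] (?q - 1) \<ominus> \<one> = \<zero>"
      using U g by (simp add: minus_eq UP.minus_eq)
    thus False
      using q by (simp add: nat_pow_zero)
  qed
  hence "count (roots P) a = 1" if "a \<in># roots P" for a
    using that by (simp add: le_antisym)
  hence "size (roots P) = card (set_mset (roots P))"
    by (simp add: size_multiset_overloaded_eq)
  moreover have "size (roots P) = ?q"
    using roots_over_carrier[OF P] degree_P by (simp add: splitted_def)
  ultimately show ?thesis
    by (simp add: roots_P)
qed

text \<open>Since x -> x^q is additive and multiplicative, its fixed points in an algebraic closure
  of the prime field form a subfield. The element type is the one in which that closure is built
  over \<open>int\<close>.\<close>

lemma exists_finite_field:
  assumes "primepow q"
  shows "\<exists>K :: ((int list \<times> nat) multiset \<Rightarrow> int) ring. field K \<and> card (carrier K) = q"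
proof -
  obtain p m where p: "Factorial_Ring.prime p" and m: "m > 0" and q: "q = p ^ m"
    using assms unfolding primepow_def by auto
  define F where "F = residue_ring (int p)"
  interpret F: residues_prime p F
    unfolding F_def using p by (rule residues_prime.intro)
  obtain L :: "((int list \<times> nat) multiset \<Rightarrow> int) ring"
    where L: "algebraic_closure L (F.indexed_const ` carrier F)"
    and hom: "F.indexed_const \<in> ring_hom F L"
    by (rule F.exists_closure)
  interpret L: algebraic_closure L "F.indexed_const ` carrier F" by (rule L)
  interpret h: ring_hom_ring F L F.indexed_const
    using hom by (intro ring_hom_ringI2) unfold_locales
  have char: "[p] \<cdot>\<^bsub>L\<^esub> \<one>\<^bsub>L\<^esub> = \<zero>\<^bsub>L\<^esub>"
    using h.hom_add_pow_nat[of "\<one>\<^bsub>F\<^esub>" p] h.hom_one h.hom_zero F.add_pow_one[of p] F.res_zero_eq by fastforce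
  let ?K = "{x \<in> carrier L. x [^]\<^bsub>L\<^esub> q = x}"
  have "subfield ?K L"
  proof (intro L.subfieldI' L.subringI)
    fix x y assume "x \<in> ?K" "y \<in> ?K"
    thus "x \<oplus>\<^bsub>L\<^esub> y \<in> ?K"
      using L.frobenius_pow_add[OF p char] unfolding q by auto
  next
    fix x y assume "x \<in> ?K" "y \<in> ?K"
    thus "x \<otimes>\<^bsub>L\<^esub> y \<in> ?K"
      by (auto simp: L.nat_pow_distrib)
  next
    fix x assume "x \<in> ?K"
    thus "\<ominus>\<^bsub>L\<^esub> x \<in> ?K"
      using L.frobenius_pow_uminus[OF p char] unfolding q by auto
  next
    fix x assume "x \<in> ?K - {\<zero>\<^bsub>L\<^esub>}"
    hence x: "x \<in> Units L" "x \<in> carrier L" and fix_x: "x [^]\<^bsub>L\<^esub> q = x"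
      by (auto simp: L.field_Units)
    \<comment> \<open>As x = x^q, the q-th power of the inverse is again an inverse of x; uniqueness
      of inverses finishes the case.\<close>
    have "x \<otimes>\<^bsub>L\<^esub> (inv\<^bsub>L\<^esub> x) [^]\<^bsub>L\<^esub> q = (x \<otimes>\<^bsub>L\<^esub> inv\<^bsub>L\<^esub> x) [^]\<^bsub>L\<^esub> q"
      using x fix_x L.nat_pow_distrib[of x "inv\<^bsub>L\<^esub> x" q] by (metis L.Units_inv_closed)
    also have "\<dots> = \<one>\<^bsub>L\<^esub>"
      using x by simp
    finally have "inv\<^bsub>L\<^esub> x = (inv\<^bsub>L\<^esub> x) [^]\<^bsub>L\<^esub> q"
      using x by (intro L.comm_inv_char) auto
    thus "inv\<^bsub>L\<^esub> x \<in> ?K"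
      using x by simp
  qed auto
  hence "field (L\<lparr>carrier := ?K\<rparr>)"
    by (rule L.subfield_iff(2))
  moreover have "card ?K = q"
    unfolding q by (rule L.card_frobenius_pow_fixed[OF p char m])
  ultimately show ?thesis by (intro exI[of _ "L\<lparr>carrier := ?K\<rparr>"]) simp
qed

section \<open>Counting in vector spaces over a finite field\<close>

lemma card_vimage_const_fibres:
  assumes "finite A" and "finite B" and "\<And>b. b \<in> B \<Longrightarrow> card {x \<in> A. f x = b} = k"
  shows "card {x \<in> A. f x \<in> B} = k * card B"
proof -
  have "{x \<in> A. f x \<in> B} = (\<Union>b\<in>B. {x \<in> A. f x = b})" by auto
  also have "card \<dots> = (\<Sum>b\<in>B. card {x \<in> A. f x = b})"
    using assms(1,2) by (intro card_UN_disjoint) auto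
  finally show ?thesis using assms(3) by simp
qed

locale finite_field_space = field R for R (structure) +
  fixes n :: nat
  assumes finite_carrier: "finite (carrier R)"
begin

section \<open>Coordinate vectors and the dot product\<close>

text \<open>Extensional functions make equality of vectors coordinatewise and the space a finite
  set.\<close>

definition vecs :: "(nat \<Rightarrow> 'a) set" where
  "vecs = {..<n} \<rightarrow>\<^sub>E carrier R"

definition vadd :: "(nat \<Rightarrow> 'a) \<Rightarrow> (nat \<Rightarrow> 'a) \<Rightarrow> nat \<Rightarrow> 'a" where
  "vadd x y = (\<lambda>i\<in>{..<n}. x i \<oplus> y i)"

definition vscale :: "'a \<Rightarrow> (nat \<Rightarrow> 'a) \<Rightarrow> nat \<Rightarrow> 'a" where
  "vscale c x = (\<lambda>i\<in>{..<n}. c \<otimes> x i)"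

definition vzero :: "nat \<Rightarrow> 'a" where
  "vzero = (\<lambda>i\<in>{..<n}. \<zero>)"

definition axis :: "nat \<Rightarrow> 'a \<Rightarrow> nat \<Rightarrow> 'a" where
  "axis j c = (\<lambda>i\<in>{..<n}. if i = j then c else \<zero>)"

definition dot :: "(nat \<Rightarrow> 'a) \<Rightarrow> (nat \<Rightarrow> 'a) \<Rightarrow> 'a" where
  "dot x y = (\<Oplus>i\<in>{..<n}. x i \<otimes> y i)"

text \<open>The points of PG(n-1,q), each line through the origin being represented by its vector
  with first nonzero coordinate 1. This avoids a quotient.\<close>

definition proj_points :: "(nat \<Rightarrow> 'a) set" where
  "proj_points = {a \<in> vecs. \<exists>j<n. a j = \<one> \<and> (\<forall>i<j. a i = \<zero>)}"

lemma vecs_nth [simp]: "x \<in> vecs \<Longrightarrow> i < n \<Longrightarrow> x i \<in> carrier R"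
  by (auto simp: vecs_def)

lemma vecs_eqI:
  assumes "x \<in> vecs" "y \<in> vecs" and "\<And>i. i < n \<Longrightarrow> x i = y i"
  shows "x = y"
  using assms unfolding vecs_def by (intro PiE_ext) auto

lemma vadd_closed [simp]: "x \<in> vecs \<Longrightarrow> y \<in> vecs \<Longrightarrow> vadd x y \<in> vecs"
  by (auto simp: vecs_def vadd_def)

lemma vscale_closed [simp]: "c \<in> carrier R \<Longrightarrow> x \<in> vecs \<Longrightarrow> vscale c x \<in> vecs"
  by (auto simp: vecs_def vscale_def)

lemma axis_closed [simp]: "c \<in> carrier R \<Longrightarrow> axis j c \<in> vecs"
  by (auto simp: vecs_def axis_def)

lemma vzero_closed [simp]: "vzero \<in> vecs"
  by (auto simp: vecs_def vzero_def)

lemma finite_vecs: "finite vecs"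
  unfolding vecs_def using finite_carrier by (intro finite_PiE) auto

lemma card_vecs: "card vecs = card (carrier R) ^ n"
  unfolding vecs_def by (simp add: card_PiE)

lemma dot_closed [simp]: "x \<in> vecs \<Longrightarrow> y \<in> vecs \<Longrightarrow> dot x y \<in> carrier R"
  unfolding dot_def by (intro finsum_closed) auto

lemma dot_comm: "x \<in> vecs \<Longrightarrow> y \<in> vecs \<Longrightarrow> dot x y = dot y x"
  unfolding dot_def by (intro finsum_cong') (auto simp: m_comm)

lemma dot_vadd:
  assumes "a \<in> vecs" "x \<in> vecs" "y \<in> vecs"
  shows "dot a (vadd x y) = dot a x \<oplus> dot a y"
proof -
  have "dot a (vadd x y) = (\<Oplus>i\<in>{..<n}. a i \<otimes> x i \<oplus> a i \<otimes> y i)"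
    unfolding dot_def vadd_def using assms by (intro finsum_cong') (auto simp: r_distr)
  also have "\<dots> = dot a x \<oplus> dot a y"
    unfolding dot_def using assms by (intro finsum_addf) auto
  finally show ?thesis .
qed

lemma dot_vscale:
  assumes "a \<in> vecs" "x \<in> vecs" "c \<in> carrier R"
  shows "dot a (vscale c x) = c \<otimes> dot a x"
proof -
  have "dot a (vscale c x) = (\<Oplus>i\<in>{..<n}. c \<otimes> (a i \<otimes> x i))"
    unfolding dot_def vscale_def using assms by (intro finsum_cong') (auto simp: m_lcomm)
  also have "\<dots> = c \<otimes> dot a x"
    unfolding dot_def using assms by (intro finsum_rdistr[symmetric]) auto
  finally show ?thesis .
qed

lemma dot_axis:
  assumes "a \<in> vecs" "j < n" "c \<in> carrier R"
  shows "dot a (axis j c) = a j \<otimes> c"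
proof -
  have "dot a (axis j c) = (\<Oplus>i\<in>{..<n}. if j = i then a i \<otimes> c else \<zero>)"
    unfolding dot_def axis_def using assms by (intro finsum_cong') auto
  also have "\<dots> = a j \<otimes> c"
    using assms by (intro finsum_singleton) auto
  finally show ?thesis .
qed

lemma dot_vzero: "x \<in> vecs \<Longrightarrow> dot x vzero = \<zero>"
  unfolding dot_def vzero_def by (intro add.finprod_one_eqI) auto

section \<open>Fibres of linear maps and affine hyperplanes\<close>

lemma vadd_right_cancel:
  assumes "x \<in> vecs" "y \<in> vecs" "z \<in> vecs" and "vadd x z = vadd y z"
  shows "x = y"
proof (rule vecs_eqI[OF assms(1,2)])
  fix i assume i: "i < n"
  hence "x i \<oplus> z i = y i \<oplus> z i"
    using fun_cong[OF assms(4), of i] by (simp add: vadd_def)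
  thus "x i = y i" using assms i by simp
qed

lemma inv_nonzero:
  assumes "c \<in> carrier R" "c \<noteq> \<zero>"
  shows "inv c \<in> carrier R" "inv c \<otimes> c = \<one>" "inv c \<noteq> \<zero>"
proof -
  have "c \<in> Units R" using assms field_Units by simp
  thus "inv c \<in> carrier R" "inv c \<otimes> c = \<one>" by simp_all
  thus "inv c \<noteq> \<zero>" using assms by auto
qed

text \<open>Translations permute the fibres of a linear map, so the fibres of a surjective one have equal size.\<close>

lemma card_linear_fibre:
  assumes range: "\<And>x. x \<in> vecs \<Longrightarrow> f x \<in> B"
    and shift: "\<And>s t. s \<in> B \<Longrightarrow> t \<in> B \<Longrightarrow> \<exists>z\<in>vecs. \<forall>x\<in>vecs. f x = s \<longrightarrow> f (vadd x z) = t"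
    and B: "finite B" and s: "s \<in> B"
  shows "card vecs = card {x \<in> vecs. f x = s} * card B"
proof -
  have le: "card {x \<in> vecs. f x = s} \<le> card {x \<in> vecs. f x = t}" if st: "s \<in> B" "t \<in> B" for s t
  proof -
    obtain z where z: "z \<in> vecs" "\<forall>x\<in>vecs. f x = s \<longrightarrow> f (vadd x z) = t"
      using shift[OF st] by blast
    show ?thesis
    proof (rule card_inj_on_le)
      show "inj_on (\<lambda>x. vadd x z) {x \<in> vecs. f x = s}"
        using vadd_right_cancel z(1) by (auto intro!: inj_onI)
      show "(\<lambda>x. vadd x z) ` {x \<in> vecs. f x = s} \<subseteq> {x \<in> vecs. f x = t}"
        using z by auto
    qed (simp add: finite_vecs)
  qed
  have "vecs = {x \<in> vecs. f x \<in> B}" using range by auto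
  moreover have "card {x \<in> vecs. f x \<in> B} = card {x \<in> vecs. f x = s} * card B"
    using le s by (intro card_vimage_const_fibres finite_vecs B) (auto intro: le_antisym)
  ultimately show ?thesis by simp
qed

lemma vec_nonzero_nth:
  assumes "a \<in> vecs" "a \<noteq> vzero"
  obtains j where "j < n" "a j \<noteq> \<zero>"
  using vecs_eqI[OF assms(1) vzero_closed] assms(2) by (auto simp: vzero_def)

text \<open>Provides the translations between fibres that \<open>card_linear_fibre\<close> asks
  for.\<close>

lemma dot_shift:
  assumes "a \<in> vecs" "x \<in> vecs" "z \<in> vecs" "t \<in> carrier R" and "dot a z = t \<ominus> dot a x"
  shows "dot a (vadd x z) = t"
proof -
  have "dot a (vadd x z) = dot a x \<oplus> (t \<oplus> \<ominus> dot a x)"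
    using assms by (simp add: dot_vadd minus_eq)
  thus ?thesis using assms by (simp add: a_comm[of t] r_neg2)
qed

text \<open>A suitable multiple of the basis vector at a nonzero coordinate of \<open>a\<close>
  works.\<close>

lemma exists_dot_eq:
  assumes a: "a \<in> vecs" "a \<noteq> vzero" and u: "u \<in> carrier R"
  shows "\<exists>z\<in>vecs. dot a z = u"
proof -
  obtain j where j: "j < n" "a j \<noteq> \<zero>" using vec_nonzero_nth[OF a] .
  note inv = inv_nonzero[OF vecs_nth[OF a(1) j(1)] j(2)]
  have "dot a (axis j (inv (a j) \<otimes> u)) = (inv (a j) \<otimes> a j) \<otimes> u"
    using a j u inv(1) by (simp add: dot_axis m_assoc m_lcomm)
  hence "dot a (axis j (inv (a j) \<otimes> u)) = u"
    using inv(2) u by simp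
  thus ?thesis using inv(1) u by (intro bexI[of _ "axis j (inv (a j) \<otimes> u)"]) auto
qed

text \<open>A nonzero functional is onto, so its q fibres share the q^n vectors equally.\<close>

lemma card_hyperplane:
  assumes a: "a \<in> vecs" "a \<noteq> vzero" and s: "s \<in> carrier R"
  shows "card {x \<in> vecs. dot a x = s} = card (carrier R) ^ (n - 1)"
proof -
  have "card vecs = card {x \<in> vecs. dot a x = s} * card (carrier R)"
  proof (rule card_linear_fibre[OF _ _ finite_carrier s])
    fix s t assume st: "s \<in> carrier R" "t \<in> carrier R"
    then obtain z where "z \<in> vecs" "dot a z = t \<ominus> s"
      using exists_dot_eq[OF a, of "t \<ominus> s"] by auto
    thus "\<exists>z\<in>vecs. \<forall>x\<in>vecs. dot a x = s \<longrightarrow> dot a (vadd x z) = t"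
      using a st dot_shift by blast
  qed (use a in simp)
  \<comment> \<open>A nonzero vector has a coordinate, so the truncated difference n - 1 is
    genuine.\<close>
  moreover have "n > 0" using vec_nonzero_nth[OF a] by (metis not_less_zero gr0I)
  hence "card vecs = card (carrier R) ^ (n - 1) * card (carrier R)"
    unfolding card_vecs by (metis power_minus_mult)
  moreover have "card (carrier R) > 0"
    using finite_carrier card_gt_0_iff by fastforce
  ultimately show ?thesis by simp
qed

section \<open>Projective points and pairs of hyperplanes\<close>

lemma proj_points_vecs: "a \<in> proj_points \<Longrightarrow> a \<in> vecs"
  by (simp add: proj_points_def)

lemma proj_points_nonzero: "a \<in> proj_points \<Longrightarrow> a \<noteq> vzero"
  by (auto simp: proj_points_def vzero_def)

text \<open>Linear independence of distinct projective points, in the form of a nonzero 2x2 minor.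
  If all minors vanished, the one at the leading positions i of \<open>a\<close> and j of
  \<open>b\<close> would force i = j, and those involving i would then give a = b.\<close>

lemma proj_points_minor_nonzero:
  assumes a: "a \<in> proj_points" and b: "b \<in> proj_points" and ne: "a \<noteq> b"
  shows "\<exists>i<n. \<exists>j<n. a i \<otimes> b j \<noteq> a j \<otimes> b i"
proof (rule ccontr)
  assume "\<not> ?thesis"
  hence minor: "a i \<otimes> b j = a j \<otimes> b i" if "i < n" "j < n" for i j
    using that by blast
  note av = proj_points_vecs[OF a] and bv = proj_points_vecs[OF b]
  obtain i where i: "i < n" "a i = \<one>" "\<And>k. k < i \<Longrightarrow> a k = \<zero>"
    using a by (auto simp: proj_points_def)
  obtain j where j: "j < n" "b j = \<one>" "\<And>k. k < j \<Longrightarrow> b k = \<zero>"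
    using b by (auto simp: proj_points_def)
  have "a j \<otimes> b i = \<one>"
    using minor[OF i(1) j(1)] i j by simp
  hence "a j \<noteq> \<zero>" "b i \<noteq> \<zero>"
    using i(1) j(1) av bv by auto
  hence "i = j"
    using i(3) j(3) by (meson linorder_neqE_nat)
  have "a = b"
  proof (rule vecs_eqI[OF av bv])
    fix k assume "k < n"
    thus "a k = b k"
      using minor[OF i(1), of k] i(2) j(2) av bv \<open>i = j\<close> by simp
  qed
  thus False using ne by simp
qed

text \<open>Cramer's rule in two coordinates where the minor of \<open>a\<close> and
  \<open>b\<close> is nonzero, all other coordinates of the solution being zero.\<close>

lemma exists_dot_pair_eq:
  assumes a: "a \<in> proj_points" and b: "b \<in> proj_points" and ne: "a \<noteq> b"
    and u: "u \<in> carrier R" and v: "v \<in> carrier R"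
  shows "\<exists>z\<in>vecs. dot a z = u \<and> dot b z = v"
proof -
  note av = proj_points_vecs[OF a] and bv = proj_points_vecs[OF b]
  obtain i j where ij: "i < n" "j < n" and minor: "a i \<otimes> b j \<noteq> a j \<otimes> b i"
    using proj_points_minor_nonzero[OF a b ne] by blast
  define d where "d = a i \<otimes> b j \<ominus> a j \<otimes> b i"
  have d: "d \<in> carrier R" "d \<noteq> \<zero>"
    unfolding d_def using av bv ij minor by auto
  note inv = inv_nonzero[OF d]
  \<comment> \<open>The vectors \<open>y\<close> and \<open>z\<close> carry the columns of the
    adjugate of the 2x2 matrix with rows (a i, a j) and (b i, b j).\<close>
  define y where "y = vadd (axis i (b j)) (axis j (\<ominus> b i))"
  define z where "z = vadd (axis i (\<ominus> a j)) (axis j (a i))"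
  have vec: "y \<in> vecs" "z \<in> vecs"
    unfolding y_def z_def using av bv ij by auto
  have "dot a y = d" "dot b y = \<zero>" "dot a z = \<zero>" "dot b z = d"
    unfolding y_def z_def d_def using av bv ij
    by (simp_all add: dot_vadd dot_axis minus_eq r_minus m_comm r_neg l_neg a_comm)
  hence "dot a (vadd (vscale (u \<otimes> inv d) y) (vscale (v \<otimes> inv d) z)) = u \<otimes> (inv d \<otimes> d)"
    "dot b (vadd (vscale (u \<otimes> inv d) y) (vscale (v \<otimes> inv d) z)) = v \<otimes> (inv d \<otimes> d)"
    using av bv vec u v d(1) inv(1) by (simp_all add: dot_vadd dot_vscale m_assoc)
  thus ?thesis
    using vec u v inv by (intro bexI[of _ "vadd (vscale (u \<otimes> inv d) y) (vscale (v \<otimes> inv d) z)"]) auto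
qed

text \<open>Two independent functionals map onto pairs of scalars, giving q^2 fibres of equal
  size.\<close>

lemma card_hyperplane_inter:
  assumes a: "a \<in> proj_points" and b: "b \<in> proj_points" and ne: "a \<noteq> b" and n: "n \<ge> 2"
    and s: "s \<in> carrier R \<times> carrier R"
  shows "card {x \<in> vecs. (dot a x, dot b x) = s} = card (carrier R) ^ (n - 2)"
proof -
  note av = proj_points_vecs[OF a] and bv = proj_points_vecs[OF b]
  have "card vecs = card {x \<in> vecs. (dot a x, dot b x) = s} * card (carrier R \<times> carrier R)"
  proof (rule card_linear_fibre[OF _ _ _ s])
    fix s t assume st: "s \<in> carrier R \<times> carrier R" "t \<in> carrier R \<times> carrier R"
    obtain z where z: "z \<in> vecs" "dot a z = fst t \<ominus> fst s" "dot b z = snd t \<ominus> snd s"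
      using exists_dot_pair_eq[OF a b ne, of "fst t \<ominus> fst s" "snd t \<ominus> snd s"] st by auto
    show "\<exists>z\<in>vecs. \<forall>x\<in>vecs. (dot a x, dot b x) = s \<longrightarrow> (dot a (vadd x z), dot b (vadd x z)) = t"
      using z st dot_shift[OF av] dot_shift[OF bv] by (intro bexI[of _ z]) auto
  qed (use av bv finite_carrier in auto)
  moreover have "card vecs = card (carrier R) ^ (n - 2) * card (carrier R \<times> carrier R)"
    unfolding card_vecs card_cartesian_product using n
    by (metis le_add_diff_inverse2 power2_eq_square power_add)
  moreover have "card (carrier R \<times> carrier R) > 0"
    using finite_carrier card_gt_0_iff by fastforce
  ultimately show ?thesis by simp
qed

section \<open>Counting projective points\<close>

text \<open>Every nonzero vector is a unique nonzero multiple of a unique normalised one, so a union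
  of punctured lines has q - 1 vectors for each projective point.\<close>

lemma card_scaling_closed:
  assumes S: "S \<subseteq> vecs" "vzero \<notin> S"
    and scale: "\<And>c x. c \<in> carrier R \<Longrightarrow> c \<noteq> \<zero> \<Longrightarrow> x \<in> S \<Longrightarrow> vscale c x \<in> S"
  shows "card S = (card (carrier R) - 1) * card (S \<inter> proj_points)"
proof -
  let ?f = "\<lambda>(c, a). vscale c a"
  have "bij_betw ?f ((carrier R - {\<zero>}) \<times> (S \<inter> proj_points)) S"
    unfolding bij_betw_def
  proof
    show "inj_on ?f ((carrier R - {\<zero>}) \<times> (S \<inter> proj_points))"
    proof (rule inj_onI, unfold split_paired_all)
      fix c a d b
      assume "(c, a) \<in> (carrier R - {\<zero>}) \<times> (S \<inter> proj_points)"
        "(d, b) \<in> (carrier R - {\<zero>}) \<times> (S \<inter> proj_points)" "?f (c, a) = ?f (d, b)"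
      hence c: "c \<in> carrier R" "c \<noteq> \<zero>" and d: "d \<in> carrier R" "d \<noteq> \<zero>"
        and a: "a \<in> proj_points" and b: "b \<in> proj_points" and eq: "vscale c a = vscale d b"
        by auto
      note av = proj_points_vecs[OF a] and bv = proj_points_vecs[OF b]
      have nth: "c \<otimes> a k = d \<otimes> b k" if "k < n" for k
        using fun_cong[OF eq, of k] that by (simp add: vscale_def)
      \<comment> \<open>Otherwise some z is dual to a and orthogonal to b, and pairing the equation
        c a = d b with z gives c = 0.\<close>
      have ab: "a = b"
      proof (rule ccontr)
        assume "a \<noteq> b"
        then obtain z where z: "z \<in> vecs" "dot a z = \<one>" "dot b z = \<zero>"
          using exists_dot_pair_eq[OF a b, of \<one> \<zero>] by auto
        have "c \<otimes> dot a z = dot z (vscale c a)"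
          using av z(1) c by (simp add: dot_vscale dot_comm)
        also have "\<dots> = d \<otimes> dot b z"
          unfolding eq using bv z(1) d by (simp add: dot_vscale dot_comm)
        finally show False using z c d by simp
      qed
      obtain i where "i < n" "a i = \<one>"
        using a by (auto simp: proj_points_def)
      thus "(c, a) = (d, b)"
        using nth[of i] ab c d by simp
    qed
    show "?f ` ((carrier R - {\<zero>}) \<times> (S \<inter> proj_points)) = S"
    proof
      show "?f ` ((carrier R - {\<zero>}) \<times> (S \<inter> proj_points)) \<subseteq> S"
        using scale by auto
      show "S \<subseteq> ?f ` ((carrier R - {\<zero>}) \<times> (S \<inter> proj_points))"
      proof
        fix x assume x: "x \<in> S"
        hence xv: "x \<in> vecs" and "x \<noteq> vzero" using S by auto
        hence ex: "\<exists>j. j < n \<and> x j \<noteq> \<zero>" by (meson vec_nonzero_nth)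
        \<comment> \<open>The position of the first nonzero coordinate; dividing by that coordinate
          normalises x.\<close>
        define j where "j = (LEAST j. j < n \<and> x j \<noteq> \<zero>)"
        have j: "j < n" "x j \<noteq> \<zero>"
          using LeastI_ex[OF ex] unfolding j_def by auto
        have below: "x i = \<zero>" if "i < j" for i
          using not_less_Least[of i "\<lambda>j. j < n \<and> x j \<noteq> \<zero>"] that j(1) unfolding j_def by auto
        note inv = inv_nonzero[OF vecs_nth[OF xv j(1)] j(2)]
        let ?a = "vscale (inv (x j)) x"
        have "?a j = \<one>" "\<And>i. i < j \<Longrightarrow> ?a i = \<zero>"
          using inv j below by (auto simp: vscale_def)
        hence "?a \<in> proj_points"
          unfolding proj_points_def using inv xv j by auto
        moreover have "?a \<in> S" using scale inv x by blast
        moreover have "vscale (x j) ?a = x"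
        proof (rule vecs_eqI)
          fix i assume i: "i < n"
          have "vscale (x j) ?a i = (inv (x j) \<otimes> x j) \<otimes> x i"
            using i j xv inv(1) by (simp add: vscale_def m_assoc m_lcomm)
          thus "vscale (x j) ?a i = x i" using inv(2) i xv by simp
        qed (use inv xv j in auto)
        ultimately show "x \<in> ?f ` ((carrier R - {\<zero>}) \<times> (S \<inter> proj_points))"
          using j xv by (intro image_eqI[of _ _ "(x j, ?a)"]) auto
      qed
    qed
  qed
  hence "card S = card ((carrier R - {\<zero>}) \<times> (S \<inter> proj_points))"
    by (simp add: bij_betw_same_card)
  thus ?thesis using finite_carrier by (simp add: card_cartesian_product)
qed

lemma card_carrier_gt_1: "card (carrier R) > 1"
proof -
  have "card {\<zero>, \<one>} \<le> card (carrier R)"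
    using finite_carrier by (intro card_mono) auto
  thus ?thesis by simp
qed

lemma finite_proj_points: "finite proj_points"
  using finite_vecs by (rule finite_subset[rotated]) (auto simp: proj_points_def)

lemma card_proj_points: "(card (carrier R) - 1) * card proj_points = card (carrier R) ^ n - 1"
proof -
  have "vscale c x \<noteq> vzero" if c: "c \<in> carrier R" "c \<noteq> \<zero>" and x: "x \<in> vecs" "x \<noteq> vzero" for c x
  proof
    assume eq: "vscale c x = vzero"
    obtain j where j: "j < n" "x j \<noteq> \<zero>" using vec_nonzero_nth[OF x] .
    hence "c \<otimes> x j = \<zero>" using fun_cong[OF eq, of j] by (simp add: vscale_def vzero_def)
    thus False using c x j integral vecs_nth by blast
  qed
  hence "card (vecs - {vzero}) = (card (carrier R) - 1) * card ((vecs - {vzero}) \<inter> proj_points)"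
    by (intro card_scaling_closed) auto
  moreover have "(vecs - {vzero}) \<inter> proj_points = proj_points"
    using proj_points_vecs proj_points_nonzero by auto
  ultimately show ?thesis using finite_vecs by (simp add: card_vecs)
qed

text \<open>There are q - 1 nonzero values with q^(n-1) vectors each, and q - 1 vectors for each
  projective point.\<close>

lemma card_proj_points_off_hyperplane:
  assumes a: "a \<in> vecs" "a \<noteq> vzero"
  shows "card {x \<in> proj_points. dot a x \<noteq> \<zero>} = card (carrier R) ^ (n - 1)"
proof -
  let ?S = "{x \<in> vecs. dot a x \<in> carrier R - {\<zero>}}"
  have "card ?S = card (carrier R) ^ (n - 1) * card (carrier R - {\<zero>})"
    using finite_carrier card_hyperplane[OF a]
    by (intro card_vimage_const_fibres finite_vecs) auto
  moreover have "card ?S = (card (carrier R) - 1) * card (?S \<inter> proj_points)"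
    using a by (intro card_scaling_closed) (auto simp: dot_vzero dot_vscale integral_iff)
  moreover have "?S \<inter> proj_points = {x \<in> proj_points. dot a x \<noteq> \<zero>}"
    using a by (auto simp: proj_points_vecs)
  ultimately show ?thesis
    using card_carrier_gt_1 finite_carrier by simp
qed

lemma card_proj_points_on_hyperplane:
  assumes a: "a \<in> vecs" "a \<noteq> vzero"
  shows "card {x \<in> proj_points. dot a x = \<zero>} = card proj_points - card (carrier R) ^ (n - 1)"
proof -
  have "{x \<in> proj_points. dot a x = \<zero>} = proj_points - {x \<in> proj_points. dot a x \<noteq> \<zero>}" by auto
  thus ?thesis
    using card_proj_points_off_hyperplane[OF a] finite_proj_points by (simp add: card_Diff_subset)
qed

text \<open>There are (q-1)^2 pairs of nonzero values with q^(n-2) vectors each; passing to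
  projective points removes one factor q - 1.\<close>

lemma card_proj_points_off_two_hyperplanes:
  assumes a: "a \<in> proj_points" and b: "b \<in> proj_points" and ne: "a \<noteq> b" and n: "n \<ge> 2"
  shows "card {x \<in> proj_points. dot a x \<noteq> \<zero> \<and> dot b x \<noteq> \<zero>}
           = card (carrier R) ^ (n - 2) * (card (carrier R) - 1)"
proof -
  note av = proj_points_vecs[OF a] and bv = proj_points_vecs[OF b]
  let ?U = "carrier R - {\<zero>}"
  let ?S = "{x \<in> vecs. (dot a x, dot b x) \<in> ?U \<times> ?U}"
  have "card ?S = card (carrier R) ^ (n - 2) * card (?U \<times> ?U)"
    using finite_carrier card_hyperplane_inter[OF a b ne n]
    by (intro card_vimage_const_fibres finite_vecs) auto
  moreover have "card ?S = (card (carrier R) - 1) * card (?S \<inter> proj_points)"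
    using av bv by (intro card_scaling_closed) (auto simp: dot_vzero dot_vscale integral_iff)
  moreover have "?S \<inter> proj_points = {x \<in> proj_points. dot a x \<noteq> \<zero> \<and> dot b x \<noteq> \<zero>}"
    using av bv by (auto simp: proj_points_vecs)
  ultimately show ?thesis
    using card_carrier_gt_1 finite_carrier by (simp add: card_cartesian_product)
qed

text \<open>The points counted are those orthogonal to x - y. They are the parallel classes in which
  x and y lie on a common hyperplane, so the number becomes the intersection size of two
  columns.\<close>

lemma card_proj_points_dot_eq:
  assumes x: "x \<in> vecs" and y: "y \<in> vecs" and ne: "x \<noteq> y"
  shows "card {a \<in> proj_points. dot a x = dot a y} = card proj_points - card (carrier R) ^ (n - 1)"
proof -
  let ?z = "vadd x (vscale (\<ominus> \<one>) y)"
  have z: "?z \<in> vecs" using x y by simp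
  have "?z \<noteq> vzero"
  proof
    assume eq: "?z = vzero"
    have "x = y"
    proof (rule vecs_eqI[OF x y])
      fix i assume i: "i < n"
      hence "x i \<ominus> y i = \<zero>"
        using fun_cong[OF eq, of i] x y by (simp add: vadd_def vscale_def vzero_def l_minus minus_eq)
      thus "x i = y i" using i x y by simp
    qed
    thus False using ne by simp
  qed
  moreover have "dot a x = dot a y \<longleftrightarrow> dot ?z a = \<zero>" if "a \<in> proj_points" for a
  proof -
    have a: "a \<in> vecs" using proj_points_vecs that .
    have "dot ?z a = dot a x \<ominus> dot a y"
      using a x y z by (simp add: dot_comm[of ?z] dot_vadd dot_vscale l_minus minus_eq)
    thus ?thesis using a x y by simp
  qed
  hence "{a \<in> proj_points. dot a x = dot a y} = {a \<in> proj_points. dot ?z a = \<zero>}" by auto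
  ultimately show ?thesis using card_proj_points_on_hyperplane[OF z] by simp
qed

end

section \<open>Triple arrays from parallel classes\<close>

lemma bij_betw_div_mod:
  fixes r q :: nat
  shows "bij_betw (\<lambda>s. (s div q, s mod q)) {..<r * q} ({..<r} \<times> {..<q})"
proof (cases "q = 0")
  case False
  show ?thesis
  proof (rule bij_betwI[where g = "\<lambda>(a, b). a * q + b"])
    show "(\<lambda>(a, b). a * q + b) \<in> {..<r} \<times> {..<q} \<rightarrow> {..<r * q}"
    proof safe
      fix a b assume ab: "a < r" "b < q"
      hence "a * q + b < Suc a * q" by simp
      also have "\<dots> \<le> r * q" using ab by (intro mult_right_mono) auto
      finally show "a * q + b < r * q" .
    qed
  qed (use False in \<open>auto simp: less_mult_imp_div_less\<close>)
qed (simp add: bij_betw_def)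

lemma card_div_mod:
  fixes r q :: nat
  shows "card {s. s < r * q \<and> Q (s div q) (s mod q)} = card {(a, b). a < r \<and> b < q \<and> Q a b}"
proof (rule bij_betw_same_card)
  show "bij_betw (\<lambda>s. (s div q, s mod q)) {s. s < r * q \<and> Q (s div q) (s mod q)}
          {(a, b). a < r \<and> b < q \<and> Q a b}"
  proof (rule bij_betw_subset[OF bij_betw_div_mod])
    show "(\<lambda>s. (s div q, s mod q)) ` {s. s < r * q \<and> Q (s div q) (s mod q)}
            = {(a, b). a < r \<and> b < q \<and> Q a b}" (is "?f ` ?A = ?B")
    proof
      show "?B \<subseteq> ?f ` ?A"
      proof
        fix x assume x: "x \<in> ?B"
        hence "x \<in> {..<r} \<times> {..<q}" by auto
        then obtain s where "s < r * q" "x = ?f s"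
          using bij_betw_imp_surj_on[OF bij_betw_div_mod[of q r]] by blast
        thus "x \<in> ?f ` ?A" using x by auto
      qed
    qed (auto simp: less_mult_imp_div_less intro!: mod_less_divisor, metis mult_0_right neq0_conv not_less_zero)
  qed auto
qed

lemma card_div:
  fixes r q :: nat
  shows "card {s. s < r * q \<and> Q (s div q)} = card {a. a < r \<and> Q a} * q"
proof -
  have "{(a, b). a < r \<and> b < q \<and> Q a} = {a. a < r \<and> Q a} \<times> {..<q}" by auto
  thus ?thesis using card_div_mod[of r q "\<lambda>a b. Q a"] by (simp add: card_cartesian_product)
qed

text \<open>A column picks one hyperplane from each class, the graph of a function, so counting its
  symbols amounts to counting classes.\<close>

lemma card_graph_div_mod:
  fixes r q :: nat
  assumes "\<And>a. a < r \<Longrightarrow> f a < q"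
  shows "card {s. s < r * q \<and> f (s div q) = s mod q \<and> Q (s div q)} = card {a. a < r \<and> Q a}"
proof -
  have "{(a, b). a < r \<and> b < q \<and> f a = b \<and> Q a} = (\<lambda>a. (a, f a)) ` {a. a < r \<and> Q a}"
    using assms by auto
  hence "card {(a, b). a < r \<and> b < q \<and> f a = b \<and> Q a} = card {a. a < r \<and> Q a}"
    by (simp add: card_image inj_on_def)
  thus ?thesis using card_div_mod[of r q "\<lambda>a b. f a = b \<and> Q a"] by simp
qed

text \<open>
  Symbol \<open>s < r * q\<close> stands for the hyperplane number \<open>s mod q\<close> of the parallel class
  number \<open>s div q\<close>; \<open>D a j\<close> is the hyperplane of class \<open>a\<close> through point \<open>j\<close>, and \<open>N i a\<close>
  says that row \<open>i\<close> contains the class \<open>a\<close>.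
\<close>

lemma resolvable_uta_of_parallel_classes:
  fixes D :: "nat \<Rightarrow> nat \<Rightarrow> nat" and N :: "nat \<Rightarrow> nat \<Rightarrow> bool"
  assumes e: "e > 0" and q: "q > 0" and c: "c = q * e" and dvd: "(r - 1) dvd e * (e - 1)"
    and D: "\<And>a j. a < r \<Longrightarrow> j < c \<Longrightarrow> D a j < q"
    and points: "\<And>a b. a < r \<Longrightarrow> b < q \<Longrightarrow> card {j. j < c \<and> D a j = b} = e"
    and classes: "\<And>j t. j < c \<Longrightarrow> t < c \<Longrightarrow> j \<noteq> t \<Longrightarrow> card {a. a < r \<and> D a j = D a t} = l"
    and N_rows: "\<And>a. a < r \<Longrightarrow> card {i. i < r \<and> N i a} = e"
    and N_cols: "\<And>i. i < r \<Longrightarrow> card {a. a < r \<and> N i a} = e"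
    and N_two: "\<And>i s. i < r \<Longrightarrow> s < r \<Longrightarrow> i \<noteq> s \<Longrightarrow> card {a. a < r \<and> N i a \<and> N s a} = m"
  shows "\<exists>R C. resolvable_unordered_triple_array r c (q * r) {..<r * q} R C"
proof -
  define R where "R = (\<lambda>i. {s. s < r * q \<and> N i (s div q)})"
  define C where "C = (\<lambda>j. {s. s < r * q \<and> D (s div q) j = s mod q})"
  define cls where "cls = (\<lambda>a. {s. s < r * q \<and> s div q = a})"
  define G where "G = cls ` {..<r}"
  have div_less: "s div q < r" if "s < r * q" for s
    using that by (simp add: less_mult_imp_div_less)
  have cls_card: "card (cls a) = q" if "a < r" for a
  proof -
    have "{b. b < r \<and> b = a} = {a}" using that by auto
    thus ?thesis unfolding cls_def using card_div[of r q "\<lambda>b. b = a"] by simp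
  qed
  \<comment> \<open>A column meets each of the \<open>e\<close> classes of a row once, so the
    row-column intersection is \<open>e\<close>. Two rows share \<open>m\<close> classes of
    \<open>q\<close> symbols each, and two columns share one symbol in each of the \<open>l\<close>
    classes where they agree.\<close>
  have uta: "uta_with_parameters r c (q * r) {..<r * q} R C e e (m * q) l"
    unfolding uta_with_parameters_def
  proof (intro conjI ballI allI impI)
    show "card (R i) = c" if "i < r" for i
      unfolding R_def card_div N_cols[OF that] c by simp
    show "card (C j) = r" if "j < c" for j
      unfolding C_def using card_graph_div_mod[of r "\<lambda>a. D a j" q "\<lambda>_. True"] D that by simp
    show "card (R i \<inter> C j) = e" if "i < r" "j < c" for i j
    proof -
      have "R i \<inter> C j = {s. s < r * q \<and> D (s div q) j = s mod q \<and> N i (s div q)}"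
        unfolding R_def C_def by auto
      thus ?thesis
        using card_graph_div_mod[of r "\<lambda>a. D a j" q "N i"] D that N_cols by simp
    qed
    show "card (R i \<inter> R s) = m * q" if "i < r" "s < r" "i \<noteq> s" for i s
    proof -
      have "R i \<inter> R s = {x. x < r * q \<and> N i (x div q) \<and> N s (x div q)}"
        unfolding R_def by auto
      thus ?thesis
        using card_div[of r q "\<lambda>a. N i a \<and> N s a"] N_two[OF that] by simp
    qed
    show "card (C j \<inter> C t) = l" if "j < c" "t < c" "j \<noteq> t" for j t
    proof -
      have "C j \<inter> C t = {s. s < r * q \<and> D (s div q) j = s mod q \<and> D (s div q) j = D (s div q) t}"
        unfolding C_def by auto
      thus ?thesis
        using card_graph_div_mod[of r "\<lambda>a. D a j" q "\<lambda>a. D a j = D a t"] D that classes by simp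
    qed
    show "card {i. i < r \<and> x \<in> R i} = e" if "x \<in> {..<r * q}" for x
      unfolding R_def using N_rows[OF div_less, of x] that by simp
    show "card {j. j < c \<and> x \<in> C j} = e" if "x \<in> {..<r * q}" for x
      unfolding C_def using points[OF div_less, of x "x mod q"] that q by simp
  qed (auto simp: R_def C_def)
  have e_dvd: "e dvd c" and div_e: "c div e = q"
    using c e by auto
  have partition: "partition_on {..<r * q} G"
  proof (rule partition_onI)
    show "\<Union>G = {..<r * q}"
      unfolding G_def cls_def using div_less by auto
    show "disjnt g g'" if "g \<in> G" "g' \<in> G" "g \<noteq> g'" for g g'
      using that unfolding G_def cls_def disjnt_def by auto
    show "{} \<notin> G"
      using cls_card q unfolding G_def by (metis card.empty imageE lessThan_iff less_numeral_extra(3))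
  qed
  have card_G: "card G = r"
  proof -
    \<comment> \<open>Classes are nonempty since q > 0, and a common element determines the class
      number.\<close>
    have "inj_on cls {..<r}"
    proof (rule inj_onI)
      fix a b assume ab: "a \<in> {..<r}" "b \<in> {..<r}" "cls a = cls b"
      hence "cls a \<noteq> {}" using cls_card[of a] q by auto
      then obtain s where "s \<in> cls a" by blast
      moreover from this have "s \<in> cls b" using ab by simp
      ultimately show "a = b" unfolding cls_def by simp
    qed
    thus ?thesis unfolding G_def by (simp add: card_image)
  qed
  have group_card: "\<forall>g\<in>G. card g = c div e"
    unfolding G_def div_e using cls_card by auto
  have transversal: "\<forall>j<c. \<forall>g\<in>G. card (C j \<inter> g) = 1"
  proof (intro allI impI ballI)
    fix j g assume "j < c" "g \<in> G"
    obtain a where a: "a < r" "g = cls a" using \<open>g \<in> G\<close> unfolding G_def by auto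
    have "C j \<inter> g = {s. s < r * q \<and> D (s div q) j = s mod q \<and> s div q = a}"
      unfolding a C_def cls_def by auto
    moreover have "{b. b < r \<and> b = a} = {a}" using a by auto
    ultimately show "card (C j \<inter> g) = 1"
      using card_graph_div_mod[of r "\<lambda>a. D a j" q "\<lambda>b. b = a"] D \<open>j < c\<close> by simp
  qed
  have same_rows: "\<forall>g\<in>G. \<forall>x\<in>g. \<forall>y\<in>g. \<forall>i<r. x \<in> R i \<longleftrightarrow> y \<in> R i"
    unfolding G_def cls_def R_def by auto
  have "resolvable_unordered_triple_array r c (q * r) {..<r * q} R C"
    unfolding resolvable_unordered_triple_array_def
    by (rule exI[of _ e], rule exI[of _ e], rule exI[of _ "m * q"], rule exI[of _ l],
        intro conjI exI[of _ G]) (fact uta dvd e_dvd partition card_G group_card transversal same_rows)+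
  thus ?thesis by blast
qed

section \<open>The array of points and hyperplanes of AG(n,q)\<close>

lemma card_reindex:
  assumes "bij_betw f {..<k} A"
  shows "card {i. i < k \<and> Q (f i)} = card {x \<in> A. Q x}"
proof (rule bij_betw_same_card[of f])
  show "bij_betw f {i. i < k \<and> Q (f i)} {x \<in> A. Q x}"
    using assms by (auto simp: bij_betw_def inj_on_def)
qed

theorem theorem5:
  fixes q n :: nat
  assumes "primepow q" and "n \<ge> 2"
  shows "\<exists>(V :: nat set) R C.
    resolvable_unordered_triple_array
      ((q ^ n - 1) div (q - 1)) (q ^ n) ((q * (q ^ n - 1)) div (q - 1)) V R C"
proof -
  obtain K :: "((int list \<times> nat) multiset \<Rightarrow> int) ring"
    where K: "field K" and card_K: "card (carrier K) = q"
    using exists_finite_field[OF assms(1)] by blast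
  have q: "q > 1" using assms(1) by (rule primepow_gt_Suc_0[unfolded One_nat_def[symmetric]])
  hence finite_K: "finite (carrier K)" using card_K by (intro card_ge_0_finite) simp
  interpret finite_field_space K n
    using K finite_K by (intro finite_field_space.intro finite_field_space_axioms.intro)
  define r where "r = card proj_points"
  have r: "(q - 1) * r = q ^ n - 1"
    using card_proj_points by (simp add: card_K r_def)
  \<comment> \<open>Both divisions are exact because q - 1 is positive and (q - 1) r = q^n -
    1.\<close>
  have r_div: "(q ^ n - 1) div (q - 1) = r" and v_div: "(q * (q ^ n - 1)) div (q - 1) = q * r"
    unfolding r[symmetric] using q by (simp_all add: mult.left_commute[of q])

  \<comment> \<open>The numbering \<open>f\<close> serves both rows and parallel classes,
    \<open>g\<close> numbers the columns, and \<open>k\<close> the field elements, hence the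
    hyperplanes within each class.\<close>
  obtain f where f: "bij_betw f {..<r} proj_points"
    using ex_bij_betw_nat_finite[OF finite_proj_points] by (auto simp: r_def atLeast0LessThan)
  obtain g where g: "bij_betw g {..<q ^ n} vecs"
    using ex_bij_betw_nat_finite[OF finite_vecs] by (auto simp: card_vecs card_K atLeast0LessThan)
  obtain k where k: "bij_betw k (carrier K) {..<q}"
    using ex_bij_betw_finite_nat[OF finite_K] by (auto simp: card_K atLeast0LessThan)
  have f_proj: "f a \<in> proj_points" if "a < r" for a
    using bij_betw_apply[OF f] that by simp
  have f_vecs: "f a \<in> vecs" and f_nonzero: "f a \<noteq> vzero" if "a < r" for a
    using f_proj[OF that] proj_points_vecs proj_points_nonzero by auto
  have g_vecs: "g j \<in> vecs" if "j < q ^ n" for j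
    using bij_betw_apply[OF g] that by simp
  have k_eq_iff: "k x = k y \<longleftrightarrow> x = y" if "x \<in> carrier K" "y \<in> carrier K" for x y
    using bij_betw_imp_inj_on[OF k] that by (rule inj_on_eq_iff)

  define D where "D a j = k (dot (f a) (g j))" for a j
  define N where "N i a \<longleftrightarrow> dot (f i) (f a) \<noteq> \<zero>\<^bsub>K\<^esub>" for i a

  have "\<exists>R C. resolvable_unordered_triple_array r (q ^ n) (q * r) {..<r * q} R C"
  proof (rule resolvable_uta_of_parallel_classes[where D = D and N = N and e = "q ^ (n - 1)"
        and l = "r - q ^ (n - 1)" and m = "q ^ (n - 2) * (q - 1)"])
    show "q ^ (n - 1) > 0" "q > 0" using q by auto
    show c: "q ^ n = q * q ^ (n - 1)"
      using assms(2) by (simp flip: power_Suc)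
    have e: "q ^ (n - 1) = q * q ^ (n - 2)"
      using assms(2) by (simp add: Suc_diff_Suc numeral_2_eq_2 flip: power_Suc)
    \<comment> \<open>From (q-1)(r-1) = q(q^(n-1)-1) it follows that e(e-1) is (r-1) times
      q^(n-2)(q-1). The quotient is the number of classes common to two rows.\<close>
    have "(q - 1) * (r - 1) = q ^ n - 1 - (q - 1)"
      by (simp only: diff_mult_distrib2 r mult_1_right)
    also have "\<dots> = q * (q ^ (n - 1) - 1)"
      using q by (simp add: c diff_mult_distrib2)
    finally have r_minus_1: "(q - 1) * (r - 1) = q * (q ^ (n - 1) - 1)" .
    have "q ^ (n - 1) * (q ^ (n - 1) - 1) = q ^ (n - 2) * (q * (q ^ (n - 1) - 1))"
      by (subst e) (simp only: mult_ac)
    also have "\<dots> = (r - 1) * (q ^ (n - 2) * (q - 1))"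
      unfolding r_minus_1[symmetric] by (simp only: mult_ac)
    finally show "(r - 1) dvd q ^ (n - 1) * (q ^ (n - 1) - 1)" by simp
  next
    fix a j assume "a < r" "j < q ^ n"
    thus "D a j < q"
      using bij_betw_apply[OF k, of "dot (f a) (g j)"] f_vecs g_vecs by (simp add: D_def)
  next
    fix a b assume a: "a < r" and "b < q"
    then obtain s where s: "s \<in> carrier K" "k s = b"
      using bij_betw_imp_surj_on[OF k] by (metis imageE lessThan_iff)
    have "{j. j < q ^ n \<and> D a j = b} = {j. j < q ^ n \<and> dot (f a) (g j) = s}"
      using a s k_eq_iff f_vecs g_vecs by (auto simp: D_def)
    thus "card {j. j < q ^ n \<and> D a j = b} = q ^ (n - 1)"
      using card_hyperplane[OF f_vecs[OF a] f_nonzero[OF a] s(1)]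
      by (simp add: card_reindex[OF g, of "\<lambda>x. dot (f a) x = s"] card_K)
  next
    fix j t assume jt: "j < q ^ n" "t < q ^ n" "j \<noteq> t"
    hence ne: "g j \<noteq> g t"
      using bij_betw_imp_inj_on[OF g] by (auto simp: inj_on_def)
    have "{a. a < r \<and> D a j = D a t} = {a. a < r \<and> dot (f a) (g j) = dot (f a) (g t)}"
      using jt k_eq_iff f_vecs g_vecs by (auto simp: D_def)
    thus "card {a. a < r \<and> D a j = D a t} = r - q ^ (n - 1)"
      using card_proj_points_dot_eq[OF g_vecs[OF jt(1)] g_vecs[OF jt(2)] ne]
      by (simp add: card_reindex[OF f, of "\<lambda>x. dot x (g j) = dot x (g t)"] card_K flip: r_def)
  next
    fix i assume i: "i < r"
    show *: "card {a. a < r \<and> N i a} = q ^ (n - 1)"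
      using card_proj_points_off_hyperplane[OF f_vecs[OF i] f_nonzero[OF i]]
      by (simp add: N_def card_reindex[OF f, of "\<lambda>x. dot (f i) x \<noteq> \<zero>\<^bsub>K\<^esub>"] card_K)
    \<comment> \<open>Symmetry of the dot product turns the count of classes in a row into the count
      of rows containing a class.\<close>
    have "{a. a < r \<and> N a i} = {a. a < r \<and> N i a}"
      using dot_comm[OF f_vecs f_vecs] i by (auto simp: N_def)
    thus "card {a. a < r \<and> N a i} = q ^ (n - 1)"
      using * by simp
  next
    fix i s assume ij: "i < r" "s < r" "i \<noteq> s"
    hence ne: "f i \<noteq> f s"
      using bij_betw_imp_inj_on[OF f] by (auto simp: inj_on_def)
    show "card {a. a < r \<and> N i a \<and> N s a} = q ^ (n - 2) * (q - 1)"
      using card_proj_points_off_two_hyperplanes[OF f_proj[OF ij(1)] f_proj[OF ij(2)] ne assms(2)]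
      by (simp add: N_def card_K
          card_reindex[OF f, of "\<lambda>x. dot (f i) x \<noteq> \<zero>\<^bsub>K\<^esub> \<and> dot (f s) x \<noteq> \<zero>\<^bsub>K\<^esub>"])
  qed
  thus ?thesis unfolding r_div v_div by blast
qed

end
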